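(* Let $n\geq 2$, let $R>0$, and choose $x_1,x_2\in\mathbb{R}^n$ with $|x_1-x_2|>2R$. Then there are constants $a<b$ and $C<0$ and a smooth function $u$ on the disjoint union $$\Omega=B_R(x_1)\cup B_R(x_2)$$ such that $$ \begin{cases} -\operatorname{div}\left(\dfrac{Du}{\sqrt{1+|Du|^2}}\right)=\dfrac{1}{\sqrt{1+|Du|^2}} & \text{in }\Omega,\\ u=a & \text{on }\Gamma_1:=\partial B_R(x_1),\\ u=b & \text{on }\Gamma_2:=\partial B_R(x_2),\\ \partial_\nu u=C & \text{on }\partial\Omega. \end{cases} $$ Thus this problem has the form of a two-height overdetermined problem ($u=a$ on $\Gamma_1$, $u=b$ on $\Gamma_2$, $\partial_\nu u=\Gamma H+C$ on $\partial\Omega=\Gamma_1\cup\Gamma_2$) with $\Gamma=0\geq 0$, but $\Omega$ is not a spherical shell.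
   Context: $B_R(x_i)$ is the open ball of radius $R$ centered at $x_i$; $\nu$ is the outer unit normal of $\Omega$; $u$ is smooth up to the boundary. $H=-\frac{1}{n-1}\operatorname{div}_{\partial\Omega}\nu$ is the normalized mean curvature of $\partial\Omega$. A spherical shell is a set of the form $B_{R'}(x_0)\setminus\overline{B_{r'}(x_0)}$ with $0<r'<R'$. *)

theory Defs
  imports "HOL-Analysis.Analysis"
begin

text \<open>The predicates \<open>Ck_on\<close> and \<open>smooth_on\<close> are meant for open sets only.\<close>

fun Ck_on :: "nat \<Rightarrow> 'a::euclidean_space set \<Rightarrow> ('a \<Rightarrow> real) \<Rightarrow> bool" where
  "Ck_on 0 U f \<longleftrightarrow> continuous_on U f"
| "Ck_on (Suc k) U f \<longleftrightarrow>
     (\<forall>x\<in>U. f differentiable (at x)) \<and>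
     (\<forall>e\<in>Basis. Ck_on k U (\<lambda>x. frechet_derivative f (at x) e))"

definition smooth_on :: "'a::euclidean_space set \<Rightarrow> ('a \<Rightarrow> real) \<Rightarrow> bool" where
  "smooth_on U f \<longleftrightarrow> (\<forall>k. Ck_on k U f)"

text \<open>
  Smoothness up to the boundary is smoothness of an extension to an open neighbourhood of the
  closure. Since functions are total, \<open>u\<close> itself plays the role of that extension; its derivatives
  at boundary points are the limits of its derivatives inside \<open>\<Omega>\<close>.
\<close>

definition smooth_up_to_boundary :: "'a::euclidean_space set \<Rightarrow> ('a \<Rightarrow> real) \<Rightarrow> bool" where
  "smooth_up_to_boundary \<Omega> u \<longleftrightarrow> (\<exists>U. open U \<and> closure \<Omega> \<subseteq> U \<and> smooth_on U u)"

definition grad :: "('a::euclidean_space \<Rightarrow> real) \<Rightarrow> 'a \<Rightarrow> 'a" where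
  "grad u x = (\<Sum>e\<in>Basis. frechet_derivative u (at x) e *\<^sub>R e)"

definition divergence :: "('a::euclidean_space \<Rightarrow> 'a) \<Rightarrow> 'a \<Rightarrow> real" where
  "divergence F x = (\<Sum>e\<in>Basis. frechet_derivative F (at x) e \<bullet> e)"

text \<open>
  Near the boundary point \<open>x\<close>, the set \<open>\<Omega>\<close> is the negative sublevel set of a smooth function with
  nonvanishing gradient at \<open>x\<close>.
\<close>

definition local_defining_function ::
    "'a::euclidean_space set \<Rightarrow> 'a \<Rightarrow> 'a set \<Rightarrow> ('a \<Rightarrow> real) \<Rightarrow> bool" where
  "local_defining_function \<Omega> x W \<rho> \<longleftrightarrow>
     open W \<and> x \<in> W \<and> smooth_on W \<rho> \<and> \<rho> x = 0 \<and> grad \<rho> x \<noteq> 0 \<and>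
     \<Omega> \<inter> W = {y \<in> W. \<rho> y < 0}"

definition smooth_boundary :: "'a::euclidean_space set \<Rightarrow> bool" where
  "smooth_boundary \<Omega> \<longleftrightarrow> (\<forall>x\<in>frontier \<Omega>. \<exists>W \<rho>. local_defining_function \<Omega> x W \<rho>)"

text \<open>The normalized gradient does not depend on the choice of the local defining function.\<close>

definition outer_normal :: "'a::euclidean_space set \<Rightarrow> 'a \<Rightarrow> 'a" where
  "outer_normal \<Omega> x =
     (THE v. \<exists>W \<rho>. local_defining_function \<Omega> x W \<rho> \<and> v = grad \<rho> x /\<^sub>R norm (grad \<rho> x))"

definition normal_derivative :: "'a::euclidean_space set \<Rightarrow> ('a \<Rightarrow> real) \<Rightarrow> 'a \<Rightarrow> real" where
  "normal_derivative \<Omega> u x = frechet_derivative u (at x) (outer_normal \<Omega> x)"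

text \<open>
  Divergence along \<open>\<partial>\<Omega>\<close> of a field \<open>F\<close> given on \<open>\<partial>\<Omega>\<close>: the trace over the tangent space at \<open>x\<close>,
  which is the full divergence of a local extension \<open>G\<close> minus its normal part and is independent of
  the extension.
\<close>

definition boundary_divergence :: "'a::euclidean_space set \<Rightarrow> ('a \<Rightarrow> 'a) \<Rightarrow> 'a \<Rightarrow> real" where
  "boundary_divergence \<Omega> F x =
     (THE d. \<exists>W G. open W \<and> x \<in> W \<and> G differentiable (at x) \<and>
        (\<forall>y\<in>W \<inter> frontier \<Omega>. G y = F y) \<and>
        d = divergence G x
            - frechet_derivative G (at x) (outer_normal \<Omega> x) \<bullet> outer_normal \<Omega> x)"

definition mean_curvature :: "'a::euclidean_space set \<Rightarrow> 'a \<Rightarrow> real" where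
  "mean_curvature \<Omega> x =
     - (1 / (real DIM('a) - 1)) * boundary_divergence \<Omega> (outer_normal \<Omega>) x"

definition spherical_shell :: "'a::euclidean_space set \<Rightarrow> bool" where
  "spherical_shell S \<longleftrightarrow>
     (\<exists>x0 r' R'. 0 < r' \<and> r' < R' \<and> S = ball x0 R' - closure (ball x0 r'))"

text \<open>\<open>\<Omega>\<close> is not required to be connected.\<close>

definition two_height_overdetermined_problem ::
    "'a::euclidean_space set \<Rightarrow> 'a set \<Rightarrow> 'a set \<Rightarrow> real \<Rightarrow> real \<Rightarrow> real \<Rightarrow> real \<Rightarrow> ('a \<Rightarrow> real) \<Rightarrow> bool"
  where
  "two_height_overdetermined_problem \<Omega> \<Gamma>1 \<Gamma>2 a b \<Gamma> C u \<longleftrightarrow>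
     open \<Omega> \<and> bounded \<Omega> \<and> smooth_boundary \<Omega> \<and>
     frontier \<Omega> = \<Gamma>1 \<union> \<Gamma>2 \<and> \<Gamma>1 \<inter> \<Gamma>2 = {} \<and>
     smooth_up_to_boundary \<Omega> u \<and>
     (\<forall>x\<in>\<Omega>. - divergence (\<lambda>y. grad u y /\<^sub>R sqrt (1 + (norm (grad u y))\<^sup>2)) x
               = 1 / sqrt (1 + (norm (grad u x))\<^sup>2)) \<and>
     (\<forall>x\<in>\<Gamma>1. u x = a) \<and>
     (\<forall>x\<in>\<Gamma>2. u x = b) \<and>
     (\<forall>x\<in>frontier \<Omega>. normal_derivative \<Omega> u x = \<Gamma> * mean_curvature \<Omega> x + C)"

end

theory Submission
  imports Defs
begin

text \<open>
  The equation says that the graph of \<open>u\<close> moves by translation under mean curvature flow. It is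
  invariant under adding constants to \<open>u\<close> and under translations of \<open>x\<close>, and it has a rotationally
  symmetric entire solution, the bowl soliton. Over a ball of radius \<open>R\<close> the (downward opening) bowl
  has constant height and constant normal derivative \<open>- R * g (R\<^sup>2) < 0\<close> on the boundary sphere. On a
  disjoint union of two such balls one therefore takes two congruent caps, the second one raised by
  \<open>1\<close>: the boundary heights are then \<open>0\<close> and \<open>1\<close>, and the normal derivatives agree.

  The substance is the existence of the bowl, smooth at its tip. Writing the gradient of
  \<open>- u\<close> as \<open>g (norm x ^ 2) *\<^sub>R x\<close>, the equation becomes the first-order equation
  \<open>2 * s * g' + n * g = 1 + s * g\<^sup>2 * (1 - (n - 1) * g)\<close> in \<open>s = norm x ^ 2\<close>, which degenerates at
  \<open>s = 0\<close>. Its integrated form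
  \<open>g s = 1 / n + s / 2 * radial_mean (n + 1) (g\<^sup>2 * (1 - (n - 1) * g)) s\<close> is meaningful on both sides of
  \<open>s = 0\<close>. With the nonlinearity clamped to be bounded and Lipschitz, it is solved by a contraction in
  an exponentially weighted space (\<open>radial_integral_equation\<close>). A comparison argument keeps \<open>g\<close> in
  \<open>(0, 1 / (n - 1)]\<close> for \<open>s \<ge> 0\<close>, so the clamp has no effect there, and since
  \<open>s * radial_mean m f s\<close> has one derivative more than \<open>f\<close> (\<open>has_derivative_id_radial_mean\<close>), \<open>g\<close> is
  smooth on a neighbourhood of \<open>{0..}\<close> (\<open>bowl_profile_exists\<close>). As \<open>norm x ^ 2\<close> is smooth in \<open>x\<close>, so
  is the resulting function on Euclidean space, including at the tip.

  The boundary condition refers to the outer normal through arbitrary local defining functions;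
  \<open>outer_normal_eq\<close> shows that any one of them may be used to compute it.
\<close>

section \<open>Calculus of \<open>C\<^sup>k\<close> functions\<close>

text \<open>
  The recursive clause speaks of derivatives at the points of \<open>U\<close> only, so openness of \<open>U\<close> makes
  the predicate depend on nothing but the values on \<open>U\<close>. This is what allows a derivative to be
  replaced by an explicit formula for it in \<open>Ck_on_SucI\<close>.
\<close>

lemma Ck_on_cong:
  assumes "open U" "\<And>x. x \<in> U \<Longrightarrow> f x = g x" "Ck_on k U f"
  shows "Ck_on k U g"
  using assms(2,3)
proof (induction k arbitrary: f g)
  case 0
  then show ?case by (simp add: continuous_on_eq)
next
  case (Suc k)
  have D: "(g has_derivative frechet_derivative f (at x)) (at x)" if "x \<in> U" for x
    using Suc.prems that assms(1)
    by (auto intro: has_derivative_transform_within_open simp: frechet_derivative_works)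
  then have eq: "frechet_derivative f (at x) = frechet_derivative g (at x)" if "x \<in> U" for x
    using frechet_derivative_at that by blast
  have "Ck_on k U (\<lambda>x. frechet_derivative g (at x) e)" if "e \<in> Basis" for e
    by (rule Suc.IH[where f="\<lambda>x. frechet_derivative f (at x) e"]) (use eq Suc.prems that in auto)
  moreover have "g differentiable (at x)" if "x \<in> U" for x
    using D[OF that] by (auto simp: differentiable_def)
  ultimately show ?case by simp
qed

lemma Ck_on_SucI:
  assumes "open U" "\<And>x. x \<in> U \<Longrightarrow> (f has_derivative D x) (at x)"
    and "\<And>e. e \<in> Basis \<Longrightarrow> Ck_on k U (\<lambda>x. D x e)"
  shows "Ck_on (Suc k) U f"
proof -
  have "frechet_derivative f (at x) = D x" if "x \<in> U" for x
    using assms(2)[OF that] frechet_derivative_at by metis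
  then show ?thesis
    using assms Ck_on_cong[OF assms(1)] by (auto simp: differentiable_def)
qed

lemma Ck_on_has_derivative:
  assumes "Ck_on (Suc k) U f" "x \<in> U"
  shows "(f has_derivative frechet_derivative f (at x)) (at x)"
  using assms by (simp add: frechet_derivative_works)

lemma Ck_on_partial:
  assumes "Ck_on (Suc k) U f" "e \<in> Basis"
  shows "Ck_on k U (\<lambda>x. frechet_derivative f (at x) e)"
  using assms by simp

lemma Ck_on_SucD:
  assumes "Ck_on (Suc k) U f"
  shows "Ck_on k U f"
  using assms
proof (induction k arbitrary: f)
  case 0
  then show ?case
    by (auto intro!: continuous_at_imp_continuous_on differentiable_imp_continuous_within)
qed auto

lemma Ck_on_imp_continuous_on: "Ck_on k U f \<Longrightarrow> continuous_on U f"
  by (induction k) (auto dest: Ck_on_SucD simp del: Ck_on.simps(2))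

lemma Ck_on_Un:
  assumes "open U" "open V" "Ck_on k U f" "Ck_on k V f"
  shows "Ck_on k (U \<union> V) f"
  using assms by (induction k arbitrary: f) (auto intro: continuous_on_open_Un)

lemma Ck_on_const: "open U \<Longrightarrow> Ck_on k U (\<lambda>x. c)"
proof (induction k arbitrary: c)
  case (Suc k)
  then show ?case by (intro Ck_on_SucI[where D="\<lambda>x h. 0"]) auto
qed auto

lemma Ck_on_add:
  assumes "open U" "Ck_on k U f" "Ck_on k U g"
  shows "Ck_on k U (\<lambda>x. f x + g x)"
  using assms(2,3)
proof (induction k arbitrary: f g)
  case (Suc k)
  show ?case
    by (rule Ck_on_SucI[OF assms(1) has_derivative_add[OF Ck_on_has_derivative Ck_on_has_derivative]])
       (use Suc in auto)
qed (auto intro: continuous_intros)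

lemma Ck_on_mult:
  assumes "open U" "Ck_on k U f" "Ck_on k U g"
  shows "Ck_on k U (\<lambda>x. f x * g x)"
  using assms(2,3)
proof (induction k arbitrary: f g)
  case (Suc k)
  have "Ck_on k U (\<lambda>x. f x * frechet_derivative g (at x) e + frechet_derivative f (at x) e * g x)"
    if "e \<in> Basis" for e
    by (rule Ck_on_add[OF assms(1) Suc.IH[OF Ck_on_SucD[OF Suc.prems(1)] Ck_on_partial[OF Suc.prems(2) that]]
          Suc.IH[OF Ck_on_partial[OF Suc.prems(1) that] Ck_on_SucD[OF Suc.prems(2)]]])
  with has_derivative_mult[OF Ck_on_has_derivative[OF Suc.prems(1)] Ck_on_has_derivative[OF Suc.prems(2)]]
  show ?case
    by (intro Ck_on_SucI[OF assms(1)])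
qed (auto intro: continuous_intros)

lemma Ck_on_linear:
  fixes l :: "'a::euclidean_space \<Rightarrow> real"
  assumes "open U" "bounded_linear l"
  shows "Ck_on k U l"
proof (cases k)
  case 0
  then show ?thesis using assms linear_continuous_on by auto
next
  case (Suc k')
  have "Ck_on (Suc k') U l"
    by (rule Ck_on_SucI[OF assms(1) bounded_linear_imp_has_derivative[OF assms(2)]])
       (rule Ck_on_const[OF assms(1)])
  then show ?thesis using Suc by simp
qed

lemma Ck_on_norm_sq:
  fixes x0 :: "'a::euclidean_space"
  assumes "open U"
  shows "Ck_on k U (\<lambda>x. (norm (x - x0))\<^sup>2)"
proof -
  have "Ck_on k U (\<lambda>x. (x \<bullet> e + (- (x0 \<bullet> e))))" for k and e::'a
    by (intro Ck_on_add Ck_on_const Ck_on_linear assms bounded_linear_inner_left)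
  then have c: "Ck_on k U (\<lambda>x. 2 * ((x - x0) \<bullet> e))" for k and e::'a
    by (intro Ck_on_mult Ck_on_const assms) (simp add: inner_diff_left)
  show ?thesis
  proof (cases k)
    case 0
    then show ?thesis by (auto intro!: continuous_intros)
  next
    case (Suc k')
    have "((\<lambda>x. (norm (x - x0))\<^sup>2) has_derivative (\<lambda>h. 2 * ((x - x0) \<bullet> h))) (at x)" for x
      unfolding power2_norm_eq_inner
      by (auto intro!: derivative_eq_intros simp: inner_commute)
    then have "Ck_on (Suc k') U (\<lambda>x. (norm (x - x0))\<^sup>2)"
      by (rule Ck_on_SucI[OF assms]) (rule c)
    then show ?thesis using Suc by simp
  qed
qed

lemma Ck_on_real_SucI:
  fixes f f' :: "real \<Rightarrow> real"
  assumes "open U" "\<And>x. x \<in> U \<Longrightarrow> (f has_real_derivative f' x) (at x)" "Ck_on k U f'"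
  shows "Ck_on (Suc k) U f"
  by (rule Ck_on_SucI[OF assms(1) assms(2)[unfolded has_field_derivative_def]])
     (use assms(3) in auto)

lemma Ck_on_real_SucE:
  fixes f :: "real \<Rightarrow> real"
  assumes "open U" "Ck_on (Suc k) U f"
  obtains f' where "\<And>x. x \<in> U \<Longrightarrow> (f has_real_derivative f' x) (at x)" "Ck_on k U f'"
proof -
  define f' where "f' = (\<lambda>x. frechet_derivative f (at x) 1)"
  have 1: "(f has_real_derivative f' x) (at x)" if "x \<in> U" for x
  proof -
    have "(f has_derivative frechet_derivative f (at x)) (at x)"
      using Ck_on_has_derivative assms that by blast
    then show ?thesis
      by (metis f'_def has_real_derivative has_field_derivative_def frechet_derivative_at mult.right_neutral)
  qed
  show ?thesis
    by (rule that[OF 1]) (use assms(2) in \<open>auto simp: f'_def\<close>)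
qed

text \<open>
  Induction on \<open>k\<close>: the chain rule turns a partial derivative of the composition into a product in
  which \<open>f'\<close> occurs composed with the same \<open>q\<close>, so the induction hypothesis has to range over all \<open>f\<close>.
\<close>

lemma Ck_on_compose:
  fixes f :: "real \<Rightarrow> real" and q :: "'a::euclidean_space \<Rightarrow> real"
  assumes "open U" "open J" "q ` U \<subseteq> J" "Ck_on k J f" "Ck_on k U q"
  shows "Ck_on k U (\<lambda>x. f (q x))"
  using assms(4,5)
proof (induction k arbitrary: f)
  case 0
  then show ?case using assms(3) by (auto intro: continuous_on_compose2)
next
  case (Suc k)
  obtain f' where f': "\<And>s. s \<in> J \<Longrightarrow> (f has_real_derivative f' s) (at s)" "Ck_on k J f'"
    using Ck_on_real_SucE assms(2) Suc.prems(1) by metis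
  have "((\<lambda>x. f (q x)) has_derivative (\<lambda>h. f' (q x) * frechet_derivative q (at x) h)) (at x)"
    if "x \<in> U" for x
  proof -
    have "(f has_derivative (*) (f' (q x))) (at (q x))"
      using f'(1)[of "q x"] that assms(3) by (auto simp: has_field_derivative_def)
    from has_derivative_compose[OF Ck_on_has_derivative[OF Suc.prems(2) that] this]
    show ?thesis .
  qed
  moreover have "Ck_on k U (\<lambda>x. f' (q x) * frechet_derivative q (at x) e)" if "e \<in> Basis" for e
    by (rule Ck_on_mult[OF assms(1) Suc.IH[OF f'(2) Ck_on_SucD[OF Suc.prems(2)]]
          Ck_on_partial[OF Suc.prems(2) that]])
  ultimately show ?case
    by (rule Ck_on_SucI[OF assms(1)])
qed

section \<open>Radial means\<close>

text \<open>
  For \<open>s > 0\<close> this is \<open>s powr (-(m+1)/2)\<close> times the integral of \<open>x powr ((m-1)/2) * f x\<close> over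
  \<open>{0..s}\<close>, the right inverse of the singular operator \<open>h \<mapsto> s * h' + (m+1)/2 * h\<close> that is regular
  at \<open>0\<close>. Writing \<open>x = s * t\<^sup>2\<close> leaves only integral powers, has a fixed interval of integration, and
  makes sense for \<open>s \<le> 0\<close> too; smoothness at \<open>s = 0\<close> thereby becomes an interior statement.
\<close>

definition radial_mean :: "nat \<Rightarrow> (real \<Rightarrow> real) \<Rightarrow> real \<Rightarrow> real" where
  "radial_mean m f s = integral {0..1} (\<lambda>t. 2 * t ^ m * f (s * t\<^sup>2))"

lemma scaled_mem:
  fixes J :: "real set"
  assumes "convex J" "0 \<in> J" "s \<in> J" "0 \<le> t" "t \<le> 1"
  shows "s * t\<^sup>2 \<in> J"
proof -
  have "(1 - t\<^sup>2) *\<^sub>R 0 + t\<^sup>2 *\<^sub>R s \<in> J"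
    using assms by (intro convexD) (auto simp: power_le_one)
  then show ?thesis by (simp add: mult.commute)
qed

lemma continuous_on_radial_kernel:
  fixes f :: "real \<Rightarrow> real"
  assumes "convex J" "0 \<in> J" "continuous_on J f"
  shows "continuous_on (J \<times> cbox 0 1) (\<lambda>(s, t). 2 * t ^ m * f (s * t\<^sup>2))"
proof -
  have "continuous_on (J \<times> cbox 0 1) (\<lambda>p. f (fst p * (snd p)\<^sup>2))"
    using assms by (intro continuous_on_compose2[OF assms(3)] continuous_intros) (auto intro: scaled_mem)
  then show ?thesis
    by (auto simp: case_prod_unfold intro!: continuous_intros)
qed

lemma continuous_on_radial_kernel1:
  fixes f :: "real \<Rightarrow> real"
  assumes "convex J" "0 \<in> J" "continuous_on J f" "s \<in> J"
  shows "continuous_on {0..1} (\<lambda>t. 2 * t ^ m * f (s * t\<^sup>2))"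
  using assms by (intro continuous_intros continuous_on_compose2[OF assms(3)]) (auto intro: scaled_mem)

lemma continuous_on_radial_mean:
  assumes "convex J" "0 \<in> J" "continuous_on J f"
  shows "continuous_on J (radial_mean m f)"
  using integral_continuous_on_param[OF continuous_on_radial_kernel[OF assms, of m]]
  unfolding radial_mean_def by (simp add: box_real)

lemma has_derivative_radial_mean:
  assumes J: "open J" "convex J" "0 \<in> J"
    and f: "\<And>s. s \<in> J \<Longrightarrow> (f has_real_derivative f' s) (at s)" "continuous_on J f'"
    and s: "s \<in> J"
  shows "(radial_mean m f has_real_derivative radial_mean (m + 2) f' s) (at s)"
proof -
  have cf: "continuous_on J f"
    using f(1) by (meson DERIV_isCont continuous_at_imp_continuous_on)
  have "((\<lambda>s. integral (cbox 0 1) (\<lambda>t. 2 * t ^ m * f (s * t\<^sup>2))) has_real_derivative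
      integral (cbox 0 1) (\<lambda>t. 2 * t ^ (m + 2) * f' (s * t\<^sup>2))) (at s within J)"
  proof (rule leibniz_rule_field_derivative[where fx="\<lambda>s t. 2 * t ^ (m + 2) * f' (s * t\<^sup>2)"])
    fix s t :: real assume st: "s \<in> J" "t \<in> cbox 0 1"
    then have "(f has_real_derivative f' (s * t\<^sup>2)) (at (s * t\<^sup>2))"
      using J by (intro f scaled_mem) auto
    then have "((\<lambda>s. f (s * t\<^sup>2)) has_real_derivative f' (s * t\<^sup>2) * t\<^sup>2) (at s within J)"
      by (auto intro!: DERIV_chain2[where f=f] derivative_eq_intros)
    then show "((\<lambda>s. 2 * t ^ m * f (s * t\<^sup>2)) has_real_derivative 2 * t ^ (m + 2) * f' (s * t\<^sup>2)) (at s within J)"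
      by (auto intro!: derivative_eq_intros simp: power_add power2_eq_square)
  next
    fix s assume "s \<in> J"
    then show "(\<lambda>t. 2 * t ^ m * f (s * t\<^sup>2)) integrable_on cbox 0 1"
      using continuous_on_radial_kernel1[OF J(2,3) cf, of s m]
      by (auto intro: integrable_continuous_real)
  qed (use J s continuous_on_radial_kernel[OF J(2,3) f(2), of "m+2"] in auto)
  then show ?thesis
    using at_within_open[OF s J(1)] by (simp add: radial_mean_def[abs_def] box_real)
qed

text \<open>
  Differentiating in \<open>s\<close> produces the radial mean of \<open>f'\<close> with \<open>m\<close> raised by \<open>2\<close>; hence the induction
  is over all \<open>f\<close> and \<open>m\<close> at once.
\<close>

lemma Ck_on_radial_mean:
  assumes "open J" "convex J" "0 \<in> J" "Ck_on k J f"
  shows "Ck_on k J (radial_mean m f)"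
  using assms(4)
proof (induction k arbitrary: f m)
  case 0
  then show ?case using assms by (simp add: continuous_on_radial_mean)
next
  case (Suc k)
  obtain f' where f': "\<And>s. s \<in> J \<Longrightarrow> (f has_real_derivative f' s) (at s)" "Ck_on k J f'"
    using Ck_on_real_SucE assms(1) Suc.prems by metis
  show ?case
    by (rule Ck_on_real_SucI[OF assms(1) has_derivative_radial_mean[OF assms(1-3) f'(1)]])
       (use Suc f' Ck_on_imp_continuous_on in auto)
qed

lemma radial_mean_at_0: "radial_mean m f 0 = 2 * f 0 / (m + 1)"
proof -
  have "((\<lambda>t. 2 * t ^ m * f 0) has_integral (2 * 1 ^ (m + 1) * f 0 / (m + 1) - 2 * 0 ^ (m + 1) * f 0 / (m + 1))) {0..1}"
  proof (rule fundamental_theorem_of_calculus)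
    fix t :: real
    have "((\<lambda>t. 2 * t ^ (m + 1) * f 0 / (m + 1)) has_real_derivative
        2 * (real (m + 1) * t ^ (m + 1 - Suc 0)) * f 0 / (m + 1)) (at t within {0..1})"
      by (intro DERIV_cdivide DERIV_cmult_right DERIV_cmult has_field_derivative_at_within[OF DERIV_pow])
    then show "((\<lambda>t. 2 * t ^ (m + 1) * f 0 / (m + 1)) has_vector_derivative 2 * t ^ m * f 0) (at t within {0..1})"
      by (simp add: has_real_derivative_iff_has_vector_derivative mult.assoc)
  qed simp
  from integral_unique[OF this] show ?thesis by (simp add: radial_mean_def)
qed

text \<open>
  Substitute \<open>r = sqrt s * t\<close>, so that \<open>s\<close> enters through the upper limit of integration.
\<close>

lemma radial_mean_of_pos:
  assumes "continuous_on UNIV f" "s > 0"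
  shows "radial_mean m f s = 2 * integral {0..sqrt s} (\<lambda>r. r ^ m * f (r\<^sup>2)) / sqrt s ^ (m + 1)"
proof -
  define r where "r = sqrt s"
  have r: "r > 0" "r\<^sup>2 = s" using assms by (auto simp: r_def)
  define P where "P x = integral {0..x} (\<lambda>r. r ^ m * f (r\<^sup>2))" for x
  have cont: "continuous_on A (\<lambda>r. r ^ m * f (r\<^sup>2))" for A
    by (intro continuous_intros continuous_on_compose2[OF assms(1)]) auto
  have "((\<lambda>t. 2 * t ^ m * f (s * t\<^sup>2)) has_integral
      2 * P (r * 1) / r ^ (m + 1) - 2 * P (r * 0) / r ^ (m + 1)) {0..1}"
  proof (rule fundamental_theorem_of_calculus)
    fix t :: real assume t: "t \<in> {0..1}"
    have "(P has_real_derivative (r * t) ^ m * f ((r * t)\<^sup>2)) (at (r * t) within {0..r})"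
      unfolding P_def by (rule integral_has_real_derivative) (use cont t r in \<open>auto simp: mult_left_le\<close>)
    then have "(P has_real_derivative (r * t) ^ m * f ((r * t)\<^sup>2)) (at (r * t) within (*) r ` {0..1})"
      by (rule has_field_derivative_subset) (use r in \<open>auto simp: mult_left_le\<close>)
    then have "(P \<circ> (*) r has_real_derivative (r * t) ^ m * f ((r * t)\<^sup>2) * r) (at t within {0..1})"
      by (rule DERIV_image_chain) (auto intro!: derivative_eq_intros)
    then have "((\<lambda>t. 2 * P (r * t) / r ^ (m + 1)) has_real_derivative
        2 * ((r * t) ^ m * f ((r * t)\<^sup>2) * r) / r ^ (m + 1)) (at t within {0..1})"
      by (intro DERIV_cdivide DERIV_cmult) (simp add: o_def)
    also have "2 * ((r * t) ^ m * f ((r * t)\<^sup>2) * r) / r ^ (m + 1) = 2 * t ^ m * f (s * t\<^sup>2)"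
      using r by (simp add: power_mult_distrib)
    finally show "((\<lambda>t. 2 * P (r * t) / r ^ (m + 1)) has_vector_derivative
        2 * t ^ m * f (s * t\<^sup>2)) (at t within {0..1})"
      by (simp add: has_real_derivative_iff_has_vector_derivative)
  qed simp
  then show ?thesis
    by (simp add: radial_mean_def integral_unique P_def r_def)
qed

lemma radial_mean_minus: "radial_mean m f (- s) = radial_mean m (\<lambda>x. f (- x)) s"
  by (simp add: radial_mean_def)

lemma has_derivative_id_radial_mean_pos:
  assumes f: "continuous_on UNIV f" and s: "s > 0"
  shows "((\<lambda>s. s * radial_mean m f s) has_real_derivative
           f s - (real m - 1) / 2 * radial_mean m f s) (at s)"
proof -
  define P where "P x = integral {0..x} (\<lambda>r. r ^ m * f (r\<^sup>2))" for x
  define r where "r = sqrt s"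
  have r: "r > 0" "s = r * r" "sqrt s = r" using s by (auto simp: r_def)
  have cont: "continuous_on A (\<lambda>r. r ^ m * f (r\<^sup>2))" for A
    by (intro continuous_intros continuous_on_compose2[OF f]) auto
  have "(P has_real_derivative r ^ m * f (r\<^sup>2)) (at r within {0..r + 1})"
    unfolding P_def by (rule integral_has_real_derivative) (use cont r in auto)
  then have P: "(P has_real_derivative r ^ m * f (r\<^sup>2)) (at (sqrt s))"
    using r by (simp add: at_within_Icc_at)
  have sq: "(sqrt has_real_derivative 1 / (2 * r)) (at s)"
    using DERIV_real_sqrt[OF s] r by (simp add: field_simps)
  have dP: "((\<lambda>s. P (sqrt s)) has_real_derivative r ^ m * f (r\<^sup>2) * (1 / (2 * r))) (at s)"
    by (rule DERIV_chain2[where f=P and g=sqrt, OF P sq])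
  have dq: "((\<lambda>s. sqrt s ^ (m + 1)) has_real_derivative real (m + 1) * r ^ m * (1 / (2 * r))) (at s)"
    using DERIV_chain2[where f="\<lambda>x. x ^ (m + 1)" and g=sqrt, OF DERIV_pow sq] r by simp
  have "((\<lambda>s. s * (2 * P (sqrt s) / sqrt s ^ (m + 1))) has_real_derivative
           s * ((2 * (r ^ m * f (r\<^sup>2) * (1 / (2 * r))) * sqrt s ^ (m + 1) -
               2 * P (sqrt s) * (real (m + 1) * r ^ m * (1 / (2 * r)))) / (sqrt s ^ (m + 1) * sqrt s ^ (m + 1)))
           + 1 * (2 * P (sqrt s) / sqrt s ^ (m + 1))) (at s)"
    by (intro DERIV_mult' DERIV_divide DERIV_cmult dP dq DERIV_ident) (use s in simp)
  also have "s * ((2 * (r ^ m * f (r\<^sup>2) * (1 / (2 * r))) * sqrt s ^ (m + 1) -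
               2 * P (sqrt s) * (real (m + 1) * r ^ m * (1 / (2 * r)))) / (sqrt s ^ (m + 1) * sqrt s ^ (m + 1)))
           + 1 * (2 * P (sqrt s) / sqrt s ^ (m + 1)) = f s - (real m - 1) / 2 * (2 * P r / r ^ (m + 1))"
    using r by (simp add: field_simps power2_eq_square)
  finally have "((\<lambda>s. s * (2 * P (sqrt s) / sqrt s ^ (m + 1))) has_real_derivative
           f s - (real m - 1) / 2 * (2 * P r / r ^ (m + 1))) (at s)" .
  then have "((\<lambda>s. s * radial_mean m f s) has_real_derivative
           f s - (real m - 1) / 2 * (2 * P r / r ^ (m + 1))) (at s)"
    by (rule has_field_derivative_transform_within_open[where S="{0<..}"])
       (use s in \<open>auto simp: radial_mean_of_pos[OF f] P_def\<close>)
  then show ?thesis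
    using r s by (simp add: radial_mean_of_pos[OF f] P_def)
qed

text \<open>
  The factor \<open>s\<close> gains one derivative over \<open>f\<close>, even at the singular point \<open>s = 0\<close>: positive \<open>s\<close> are
  covered by the fundamental theorem of calculus, negative \<open>s\<close> by reflecting \<open>f\<close>, and at \<open>0\<close> the
  difference quotient is the continuous function \<open>radial_mean m f\<close> itself. This gain drives the
  bootstrapping of regularity in \<open>bowl_profile_exists\<close>.
\<close>

lemma has_derivative_id_radial_mean:
  assumes f: "continuous_on UNIV f"
  shows "((\<lambda>s. s * radial_mean m f s) has_real_derivative
           f s - (real m - 1) / 2 * radial_mean m f s) (at s)"
proof -
  consider "s > 0" | "s < 0" | "s = 0" by linarith
  then show ?thesis
  proof cases
    case 1
    then show ?thesis using has_derivative_id_radial_mean_pos[OF f] by blast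
  next
    case 2
    let ?h = "\<lambda>x. f (- x)"
    have h: "continuous_on UNIV ?h"
      by (intro continuous_on_compose2[OF f] continuous_intros) auto
    have *: "((\<lambda>s. s * radial_mean m ?h s) has_real_derivative
           ?h (- s) - (real m - 1) / 2 * radial_mean m ?h (- s)) (at (- s))"
      by (rule has_derivative_id_radial_mean_pos[OF h]) (use 2 in simp)
    have "((\<lambda>s. - ((- s) * radial_mean m ?h (- s))) has_real_derivative
           - ((?h (- s) - (real m - 1) / 2 * radial_mean m ?h (- s)) * (- 1))) (at s)"
      by (rule DERIV_minus, rule DERIV_chain2[where g=uminus, OF *]) (auto intro!: derivative_eq_intros)
    then show ?thesis by (simp add: radial_mean_minus[symmetric])
  next
    case 3
    have "isCont (radial_mean m f) 0"
      using continuous_on_radial_mean[OF convex_UNIV _ f] by (simp add: continuous_on_eq_continuous_at)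
    then have "((\<lambda>s. radial_mean m f s) \<longlongrightarrow> radial_mean m f 0) (at 0)"
      by (simp add: isCont_def)
    then have "((\<lambda>h. (h * radial_mean m f h) / h) \<longlongrightarrow> radial_mean m f 0) (at 0)"
      by (rule Lim_transform_eventually) (auto simp: eventually_at_filter)
    then have "((\<lambda>s. s * radial_mean m f s) has_real_derivative radial_mean m f 0) (at 0)"
      by (simp add: DERIV_def)
    moreover have "radial_mean m f 0 = f 0 - (real m - 1) / 2 * radial_mean m f 0"
      unfolding radial_mean_at_0 by (simp add: field_simps)
    ultimately show ?thesis using 3 by simp
  qed
qed

section \<open>A singular integral equation\<close>

lemma integral_exp_weight:
  assumes "l > 0"
  shows "((\<lambda>t::real. \<bar>s\<bar> * (2 * t * exp (l * \<bar>s\<bar> * t\<^sup>2))) has_integral (exp (l * \<bar>s\<bar>) - 1) / l) {0..1}"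
proof -
  have "((\<lambda>t. \<bar>s\<bar> * (2 * t * exp (l * \<bar>s\<bar> * t\<^sup>2))) has_integral
      exp (l * \<bar>s\<bar> * 1\<^sup>2) / l - exp (l * \<bar>s\<bar> * 0\<^sup>2) / l) {0..1}"
    by (rule fundamental_theorem_of_calculus)
       (use assms in \<open>auto intro!: derivative_eq_intros
          simp: has_real_derivative_iff_has_vector_derivative[symmetric] field_simps\<close>)
  then show ?thesis by (simp add: diff_divide_distrib)
qed

text \<open>
  Bielecki's weight: in the norm weighted by \<open>exp (- l * \<bar>s\<bar>)\<close>, the Volterra operator
  \<open>f \<mapsto> s * radial_mean m f s\<close> has norm at most \<open>1 / l\<close>. One factor \<open>t\<close> out of \<open>t ^ m\<close> suffices to
  integrate the exponential exactly.
\<close>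

lemma radial_mean_exp_weight_bound:
  assumes "l > 0" "m \<ge> 1" "K \<ge> 0" "continuous_on UNIV f"
    and f: "\<And>t. 0 \<le> t \<Longrightarrow> t \<le> 1 \<Longrightarrow> \<bar>f (s * t\<^sup>2)\<bar> \<le> K * exp (l * \<bar>s\<bar> * t\<^sup>2)"
  shows "\<bar>s * radial_mean m f s\<bar> \<le> K / l * exp (l * \<bar>s\<bar>)"
proof -
  have int: "(\<lambda>t. s * (2 * t ^ m * f (s * t\<^sup>2))) integrable_on {0..1}"
    using continuous_on_radial_kernel1[OF convex_UNIV _ assms(4), of s m]
    by (auto intro!: integrable_continuous_real continuous_on_mult_left)
  have *: "norm (integral {0..1} (\<lambda>t. s * (2 * t ^ m * f (s * t\<^sup>2)))) \<le>
      integral {0..1} (\<lambda>t. K * (\<bar>s\<bar> * (2 * t * exp (l * \<bar>s\<bar> * t\<^sup>2))))"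
  proof (rule integral_norm_bound_integral[OF int])
    show "(\<lambda>t. K * (\<bar>s\<bar> * (2 * t * exp (l * \<bar>s\<bar> * t\<^sup>2)))) integrable_on {0..1}"
      using has_integral_mult_right[OF integral_exp_weight[OF assms(1)]] by blast
    fix t :: real assume t: "t \<in> {0..1}"
    have "t ^ m \<le> t ^ 1" by (rule power_decreasing) (use assms(2) t in auto)
    then have "t ^ m * \<bar>f (s * t\<^sup>2)\<bar> \<le> t * (K * exp (l * \<bar>s\<bar> * t\<^sup>2))"
      using f[of t] t by (intro mult_mono) auto
    then have "\<bar>s\<bar> * 2 * (t ^ m * \<bar>f (s * t\<^sup>2)\<bar>) \<le> \<bar>s\<bar> * 2 * (t * (K * exp (l * \<bar>s\<bar> * t\<^sup>2)))"
      by (intro mult_left_mono) auto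
    then show "norm (s * (2 * t ^ m * f (s * t\<^sup>2))) \<le> K * (\<bar>s\<bar> * (2 * t * exp (l * \<bar>s\<bar> * t\<^sup>2)))"
      using t by (simp add: abs_mult power_abs mult_ac)
  qed
  have "integral {0..1} (\<lambda>t. K * (\<bar>s\<bar> * (2 * t * exp (l * \<bar>s\<bar> * t\<^sup>2)))) = K * ((exp (l * \<bar>s\<bar>) - 1) / l)"
    using has_integral_mult_right[OF integral_exp_weight[OF assms(1)]] by (rule integral_unique)
  also have "\<dots> \<le> K / l * exp (l * \<bar>s\<bar>)"
    using assms by (simp add: field_simps)
  finally show ?thesis using * by (simp add: radial_mean_def)
qed

lemma radial_mean_diff:
  assumes "continuous_on UNIV f" "continuous_on UNIV g"
  shows "radial_mean m (\<lambda>x. f x - g x) s = radial_mean m f s - radial_mean m g s"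
proof -
  have "(\<lambda>t. 2 * t ^ m * h (s * t\<^sup>2)) integrable_on {0..1}" if "continuous_on UNIV h" for h :: "real \<Rightarrow> real"
    using continuous_on_radial_kernel1[OF convex_UNIV _ that, of s m] by (auto intro: integrable_continuous_real)
  from integral_diff[OF this[OF assms(1)] this[OF assms(2)]] show ?thesis
    unfolding radial_mean_def by (simp add: right_diff_distrib)
qed

text \<open>
  Banach's fixed point theorem. The unknown is \<open>v s = exp (- l * \<bar>s\<bar>) * g s\<close>, a bounded continuous
  function; with \<open>l\<close> above the Lipschitz constant of \<open>\<Phi>\<close> the weighted equation is a contraction with
  constant \<open>1 / 2\<close> on all of the real line, which yields a global solution at once.
\<close>

lemma radial_integral_equation:
  fixes \<Phi> :: "real \<Rightarrow> real"
  assumes L: "\<And>x y. \<bar>\<Phi> x - \<Phi> y\<bar> \<le> L * \<bar>x - y\<bar>" and B: "\<And>x. \<bar>\<Phi> x\<bar> \<le> B" and "m \<ge> 1"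
  obtains g where "continuous_on UNIV g" "\<And>s. g s = c + s / 2 * radial_mean m (\<lambda>x. \<Phi> (g x)) s"
proof -
  define l where "l = \<bar>L\<bar> + 1"
  have l: "l > 0" "L \<le> l" by (auto simp: l_def)
  have B0: "B \<ge> 0" using B[of 0] by linarith
  have "continuous_on UNIV \<Phi>"
  proof (rule lipschitz_on_continuous_on)
    show "l-lipschitz_on UNIV \<Phi>"
    proof (rule lipschitz_onI)
      fix x y show "dist (\<Phi> x) (\<Phi> y) \<le> l * dist x y"
        using L[of x y] mult_right_mono[OF l(2), of "\<bar>x - y\<bar>"] by (auto simp: dist_real_def)
    qed (use l in auto)
  qed
  note cont\<Phi> = continuous_on_compose2[OF this]
  define W where "W v x = exp (l * \<bar>x\<bar>) * v x" for v :: "real \<Rightarrow> real" and x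
  define T where "T v s = exp (- (l * \<bar>s\<bar>)) * (c + s / 2 * radial_mean m (\<lambda>x. \<Phi> (W v x)) s)"
    for v :: "real \<Rightarrow> real" and s
  have contW: "continuous_on UNIV (\<lambda>x. \<Phi> (W v x))" if "continuous_on UNIV v" for v
    unfolding W_def by (intro cont\<Phi> continuous_intros that) auto
  have T: "T v \<in> bcontfun" if v: "continuous_on UNIV v" for v
  proof (rule bcontfun_normI)
    show "continuous_on UNIV (T v)"
      unfolding T_def
      by (intro continuous_intros continuous_on_radial_mean contW v) auto
    fix s
    have "\<bar>s * radial_mean m (\<lambda>x. \<Phi> (W v x)) s\<bar> \<le> B / l * exp (l * \<bar>s\<bar>)"
    proof (rule radial_mean_exp_weight_bound[OF l(1) assms(3) B0 contW[OF v]])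
      fix t :: real
      have "\<bar>\<Phi> (W v (s * t\<^sup>2))\<bar> \<le> B * 1" using B by simp
      also have "\<dots> \<le> B * exp (l * \<bar>s\<bar> * t\<^sup>2)" using B0 l by (intro mult_left_mono) auto
      finally show "\<bar>\<Phi> (W v (s * t\<^sup>2))\<bar> \<le> B * exp (l * \<bar>s\<bar> * t\<^sup>2)" .
    qed
    then have "\<bar>c + s / 2 * radial_mean m (\<lambda>x. \<Phi> (W v x)) s\<bar> \<le> \<bar>c\<bar> * 1 + B / l * exp (l * \<bar>s\<bar>) / 2"
      using abs_triangle_ineq[of c "s * radial_mean m (\<lambda>x. \<Phi> (W v x)) s / 2"] by simp
    also have "\<dots> \<le> \<bar>c\<bar> * exp (l * \<bar>s\<bar>) + B / l * exp (l * \<bar>s\<bar>) / 2"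
      using l by (intro add_right_mono mult_left_mono) auto
    finally have "exp (- (l * \<bar>s\<bar>)) * \<bar>c + s / 2 * radial_mean m (\<lambda>x. \<Phi> (W v x)) s\<bar>
        \<le> exp (- (l * \<bar>s\<bar>)) * (\<bar>c\<bar> * exp (l * \<bar>s\<bar>) + B / l * exp (l * \<bar>s\<bar>) / 2)"
      by (intro mult_left_mono) auto
    also have "\<dots> = \<bar>c\<bar> + B / l / 2"
      by (simp add: exp_minus field_simps)
    finally show "norm (T v s) \<le> \<bar>c\<bar> + B / l / 2"
      by (simp add: T_def abs_mult)
  qed
  define S :: "(real \<Rightarrow>\<^sub>C real) \<Rightarrow> (real \<Rightarrow>\<^sub>C real)" where "S v = Bcontfun (T (apply_bcontfun v))" for v
  have S: "apply_bcontfun (S v) = T (apply_bcontfun v)" for v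
    unfolding S_def by (intro Bcontfun_inverse T) simp
  have "dist (S v) (S w) \<le> 1 / 2 * dist v w" for v w
  proof (rule dist_bound)
    fix s
    let ?f = "\<lambda>v x. \<Phi> (W (apply_bcontfun v) x)"
    have c: "continuous_on UNIV (?f v)" for v by (rule contW) simp
    have "\<bar>s * radial_mean m (\<lambda>x. ?f v x - ?f w x) s\<bar> \<le> (l * dist v w) / l * exp (l * \<bar>s\<bar>)"
    proof (rule radial_mean_exp_weight_bound[OF l(1) assms(3)])
      fix t :: real
      let ?x = "s * t\<^sup>2"
      have "\<bar>?f v ?x - ?f w ?x\<bar> \<le> l * \<bar>W (apply_bcontfun v) ?x - W (apply_bcontfun w) ?x\<bar>"
        using L[of "W (apply_bcontfun v) ?x" "W (apply_bcontfun w) ?x"]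
          mult_right_mono[OF l(2)] by (meson abs_ge_zero order_trans)
      also have "\<bar>W (apply_bcontfun v) ?x - W (apply_bcontfun w) ?x\<bar> =
          exp (l * \<bar>s\<bar> * t\<^sup>2) * dist (apply_bcontfun v ?x) (apply_bcontfun w ?x)"
        by (simp add: W_def dist_real_def right_diff_distrib[symmetric] abs_mult mult.assoc)
      also have "\<dots> \<le> exp (l * \<bar>s\<bar> * t\<^sup>2) * dist v w"
        by (intro mult_left_mono dist_bounded) auto
      finally show "\<bar>?f v ?x - ?f w ?x\<bar> \<le> l * dist v w * exp (l * \<bar>s\<bar> * t\<^sup>2)"
        using l by (simp add: mult_ac)
    qed (use l c in \<open>auto intro!: continuous_intros\<close>)
    then have *: "\<bar>s * radial_mean m (\<lambda>x. ?f v x - ?f w x) s\<bar> \<le> dist v w * exp (l * \<bar>s\<bar>)"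
      using l by simp
    have alg: "\<bar>E * (c + s / 2 * a) - E * (c + s / 2 * b)\<bar> = E * \<bar>s * (a - b)\<bar> / 2"
      if "E \<ge> 0" for E a b :: real
    proof -
      have eq: "E * (c + s / 2 * a) - E * (c + s / 2 * b) = E * (s * (a - b)) / 2"
        by (simp add: algebra_simps diff_divide_distrib)
      show ?thesis unfolding eq using that by (simp add: abs_mult)
    qed
    have "dist (apply_bcontfun (S v) s) (apply_bcontfun (S w) s) =
        exp (- (l * \<bar>s\<bar>)) * \<bar>s * radial_mean m (\<lambda>x. ?f v x - ?f w x) s\<bar> / 2"
      unfolding S T_def dist_real_def radial_mean_diff[OF c c] by (rule alg) simp
    also have "\<dots> \<le> exp (- (l * \<bar>s\<bar>)) * (dist v w * exp (l * \<bar>s\<bar>)) / 2"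
      using * by (intro divide_right_mono mult_left_mono) auto
    also have "\<dots> = 1 / 2 * dist v w"
      by (simp add: exp_minus field_simps)
    finally show "dist (apply_bcontfun (S v) s) (apply_bcontfun (S w) s) \<le> 1 / 2 * dist v w" .
  qed
  then obtain v where v: "S v = v"
    using banach_fix_type[of "1/2" S] by auto
  define g where "g = W (apply_bcontfun v)"
  show ?thesis
  proof
    show "continuous_on UNIV g"
      unfolding g_def W_def by (intro continuous_intros) auto
    show "g s = c + s / 2 * radial_mean m (\<lambda>x. \<Phi> (g x)) s" for s
      using arg_cong[OF v, of "\<lambda>v. apply_bcontfun v s"]
      unfolding S T_def g_def by (simp add: W_def exp_minus field_simps)
  qed
qed

section \<open>The profile of the bowl soliton\<close>

text \<open>
  The nonlinearity \<open>z\<^sup>2 * (1 - N * z)\<close> of the profile equation, held constant outside the interval \<open>[0, 1/N]\<close>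
  in which the solution turns out to stay. Clamping makes it bounded and globally Lipschitz.
\<close>

definition clamped_forcing :: "real \<Rightarrow> real \<Rightarrow> real" where
  "clamped_forcing N y = (let z = max 0 (min y (1 / N)) in z\<^sup>2 * (1 - N * z))"

text \<open>
  On \<open>[0, 1/N]\<close> the difference of two values is \<open>x - y\<close> times
  \<open>x + y - N * (x\<^sup>2 + x * y + y\<^sup>2)\<close>, and each of the three products with \<open>N\<close> lies in \<open>[0, 1]\<close>.
\<close>

lemma clamped_forcing_bounds:
  fixes N :: real
  assumes N: "N \<ge> 1"
  shows "\<bar>clamped_forcing N x - clamped_forcing N y\<bar> \<le> 3 * \<bar>x - y\<bar>"
    "0 \<le> clamped_forcing N x" "clamped_forcing N x \<le> 1"
proof -
  let ?\<Phi> = "clamped_forcing N"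
  define cl where "cl y = max 0 (min y (1 / N))" for y
  have cl: "0 \<le> cl y" "N * cl y \<le> 1" "cl y \<le> 1" for y
  proof -
    show "0 \<le> cl y" by (simp add: cl_def)
    have "cl y \<le> 1 / N" using N by (simp add: cl_def)
    then show "N * cl y \<le> 1" using N by (simp add: field_simps)
    show "cl y \<le> 1" using \<open>cl y \<le> 1 / N\<close> N by (meson divide_le_eq_1_pos dual_order.trans less_le_trans zero_less_one)
  qed
  have \<Phi>: "?\<Phi> y = (cl y)\<^sup>2 * (1 - N * cl y)" for y
    by (simp add: clamped_forcing_def cl_def Let_def)
  show "0 \<le> ?\<Phi> x" using cl[of x] by (simp add: \<Phi>)
  show "?\<Phi> x \<le> 1" unfolding \<Phi>
    using cl[of x] N by (intro mult_le_one) (auto simp: power_le_one)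
  let ?a = "cl x" and ?b = "cl y"
  let ?q = "?a + ?b - (N * ?a * ?a + N * ?a * ?b + N * ?b * ?b)"
  have prod: "0 \<le> N * cl u * cl v \<and> N * cl u * cl v \<le> 1" for u v
    using cl[of u] cl[of v] N by (auto intro: mult_le_one)
  have "\<bar>?q\<bar> \<le> 3"
    using prod[of x x] prod[of x y] prod[of y y] cl(1,3)[of x] cl(1,3)[of y] unfolding abs_le_iff by linarith
  have "\<bar>?a - ?b\<bar> \<le> \<bar>x - y\<bar>"
    unfolding cl_def by linarith
  have "?\<Phi> x - ?\<Phi> y = ?q * (?a - ?b)"
    by (simp add: \<Phi> power2_eq_square algebra_simps)
  then have "\<bar>?\<Phi> x - ?\<Phi> y\<bar> = \<bar>?q\<bar> * \<bar>?a - ?b\<bar>" by (simp add: abs_mult)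
  also have "\<dots> \<le> 3 * \<bar>x - y\<bar>"
    using \<open>\<bar>?q\<bar> \<le> 3\<close> \<open>\<bar>?a - ?b\<bar> \<le> \<bar>x - y\<bar>\<close> by (rule mult_mono) auto
  finally show "\<bar>?\<Phi> x - ?\<Phi> y\<bar> \<le> 3 * \<bar>x - y\<bar>" .
qed

text \<open>
  The function \<open>w x = F (norm x ^ 2)\<close> with \<open>2 * F' = g\<close> has gradient \<open>g (norm x ^ 2) *\<^sub>R x\<close>, and the
  last equation is the translator equation for its graph in terms of \<open>s = norm x ^ 2\<close>. It is singular at
  \<open>s = 0\<close>; regularity there forces \<open>g 0 = 1 / n\<close>, and inverting the linear part
  \<open>2 * s * g' + n * g\<close> gives the integral equation solved by \<open>radial_integral_equation\<close>.

  The clamp in the forcing is inactive for \<open>s \<ge> 0\<close>. From below, the forcing is nonnegative, so the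
  integral equation gives \<open>g \<ge> 1 / n\<close>. From above, at a maximum of \<open>g\<close> over \<open>{0..s}\<close> with value
  exceeding \<open>1 / (n - 1)\<close> the forcing vanishes and the equation makes \<open>g'\<close> negative there, which is
  impossible. Since \<open>g 0\<close> is in the interior of the clamping interval, the clamp is inactive on some
  \<open>{- e<..}\<close> as well. There the forcing is a polynomial in \<open>g\<close>, so \<open>g\<close> of class \<open>C\<^sup>k\<close> implies \<open>g'\<close> of
  class \<open>C\<^sup>k\<close>.
\<close>

lemma bowl_profile_exists:
  fixes n :: nat
  assumes n: "n \<ge> 2"
  obtains g g' :: "real \<Rightarrow> real" and J :: "real set"
  where "open J" "{0..} \<subseteq> J" "continuous_on UNIV g"
    and "\<And>k. Ck_on k J g"
    and "\<And>s. (g has_real_derivative g' s) (at s)"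
    and "\<And>s. s \<ge> 0 \<Longrightarrow> g s > 0"
    and "\<And>s. s \<ge> 0 \<Longrightarrow> 2 * s * g' s = 1 - n * g s + s * (g s)\<^sup>2 * (1 - (real n - 1) * g s)"
proof -
  define N where "N = real n - 1"
  have N: "N \<ge> 1" using n by (auto simp: N_def)
  define G where "G y = y\<^sup>2 * (1 - N * y)" for y
  define \<Phi> where "\<Phi> = clamped_forcing N"
  note bounds = clamped_forcing_bounds[OF N, folded \<Phi>_def]
  have \<Phi>G: "\<Phi> y = G y" if "0 \<le> y" "y \<le> 1 / N" for y
    using that by (simp add: \<Phi>_def clamped_forcing_def G_def Let_def)
  have abs_\<Phi>: "\<bar>\<Phi> x\<bar> \<le> 1" for x
    by (simp only: abs_of_nonneg[OF bounds(2)] bounds(3))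
  have "n + 1 \<ge> 1" by simp
  then obtain g where contg: "continuous_on UNIV g"
    and g: "\<And>s. g s = 1 / n + s / 2 * radial_mean (n + 1) (\<lambda>x. \<Phi> (g x)) s"
    by (rule radial_integral_equation[OF bounds(1) abs_\<Phi>]) blast
  define A where "A = radial_mean (n + 1) (\<lambda>x. \<Phi> (g x))"
  have gA: "g s = 1 / n + s / 2 * A s" for s
    unfolding A_def by (rule g)
  define g' where "g' s = 1 / 2 * (\<Phi> (g s) - real n / 2 * A s)" for s
  have cont\<Phi>: "continuous_on UNIV (\<lambda>x. \<Phi> (g x))"
    unfolding \<Phi>_def clamped_forcing_def Let_def using N by (intro continuous_intros contg) auto
  have der: "(g has_real_derivative g' s) (at s)" for s
  proof -
    have "((\<lambda>s. 1 / n + 1 / 2 * (s * A s)) has_real_derivative 0 + g' s) (at s)"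
      unfolding g'_def using has_derivative_id_radial_mean[OF cont\<Phi>, of "n + 1" s]
      by (intro DERIV_add DERIV_const DERIV_cmult) (simp add: A_def)
    moreover have "(\<lambda>s. 1 / n + 1 / 2 * (s * A s)) = g"
      by (rule ext) (subst gA, simp)
    ultimately show ?thesis by simp
  qed
  have ode: "2 * s * g' s = 1 - n * g s + s * \<Phi> (g s)" for s
  proof -
    have "n * (g s - 1 / n) = n * s / 2 * A s"
      using n by (subst gA) simp
    then show ?thesis
      using n unfolding g'_def by (simp add: algebra_simps)
  qed
  have lower: "g s \<ge> 1 / n" if "s \<ge> 0" for s
  proof -
    have "A s \<ge> 0"
      unfolding A_def radial_mean_def using bounds(2) continuous_on_radial_kernel1[OF convex_UNIV _ cont\<Phi>, of s "n + 1"]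
      by (intro integral_nonneg integrable_continuous_real) auto
    then show ?thesis using that by (subst gA) simp
  qed
  have gpos: "g s > 0" if "s \<ge> 0" for s
  proof -
    have "0 < 1 / real n" using n by simp
    then show ?thesis using lower[OF that] by linarith
  qed
  have g0: "g 0 = 1 / n" by (subst gA) simp
  have upper: "g s \<le> 1 / N" if s: "s \<ge> 0" for s
  proof (rule ccontr)
    assume *: "\<not> g s \<le> 1 / N"
    (* A maximum over the closed interval may sit at its right end, but a negative
     derivative yields larger values to the left, which is a contradiction in that case too. *)
  obtain t where t: "t \<in> {0..s}" "\<And>y. y \<in> {0..s} \<Longrightarrow> g y \<le> g t"
      using continuous_attains_sup[of "{0..s}" g] s continuous_on_subset[OF contg] by auto
    have gt: "g t > 1 / N" using t(2)[of s] * s by auto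
    have "1 / real n < 1 / N" using N by (simp add: N_def field_simps)
    then have "t \<noteq> 0" using gt g0 by auto
    then have "t > 0" using t(1) by auto
    have "\<Phi> (g t) = 0" using gt N by (simp add: \<Phi>_def clamped_forcing_def min_absorb2)
    moreover have "1 < real n * g t"
    proof -
      have "1 / real n < g t" using gt \<open>1 / real n < 1 / N\<close> by linarith
      then show ?thesis using n by (simp add: divide_less_eq mult.commute)
    qed
    ultimately have "t * g' t < 0" using ode[of t] by simp
    then have "g' t < 0" using \<open>t > 0\<close> by (simp add: mult_less_0_iff)
    then obtain d where d: "d > 0" "\<And>h. 0 < h \<Longrightarrow> h < d \<Longrightarrow> g t < g (t - h)"
      using DERIV_neg_dec_left[OF der] by blast
    define h where "h = min t d / 2"
    have "0 < h" "h < d" "t - h \<in> {0..s}" using \<open>t > 0\<close> d(1) t(1) by (auto simp: h_def)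
    then show False using d(2)[of h] t(2)[of "t - h"] by auto
  qed
  have "isCont g 0" using contg by (simp add: continuous_on_eq_continuous_at)
  moreover have "open {0<..<1 / N}" "g 0 \<in> {0<..<1 / N}"
    using n N by (auto simp: g0 N_def field_simps)
  ultimately obtain e where e: "e > 0" "\<And>s. \<bar>s\<bar> < e \<Longrightarrow> g s \<in> {0<..<1 / N}"
    unfolding continuous_at_open by (metis (no_types, lifting) open_dist dist_real_def diff_zero)
  (* The interval must contain 0 in its interior and all scalings of its points by t in [0, 1]. *)
  define J where "J = {- e<..}"
  have J: "open J" "convex J" "0 \<in> J" using e(1) by (auto simp: J_def)
  have \<Phi>J: "\<Phi> (g s) = G (g s)" if "s \<in> J" for s
  proof (cases "s \<ge> 0")
    case True
    then show ?thesis using \<Phi>G gpos upper by (simp add: less_imp_le)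
  next
    case False
    then have "g s \<in> {0<..<1 / N}" using e(2)[of s] that by (auto simp: J_def)
    then show ?thesis by (intro \<Phi>G) auto
  qed
  have Ck: "Ck_on k J g" for k
  proof (induction k)
    case 0
    then show ?case using continuous_on_subset[OF contg] by auto
  next
    case (Suc k)
    have "Ck_on k J (\<lambda>s. g s * g s * (1 + (- N) * g s))"
      by (intro Ck_on_mult Ck_on_add Ck_on_const J Suc)
    then have "Ck_on k J (\<lambda>s. \<Phi> (g s))"
      by (rule Ck_on_cong[OF J(1), rotated]) (simp add: \<Phi>J G_def power2_eq_square)
    then have "Ck_on k J (\<lambda>s. 1 / 2 * (\<Phi> (g s) + (- (real n / 2)) * A s))"
      unfolding A_def by (intro Ck_on_mult Ck_on_add Ck_on_const Ck_on_radial_mean J)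
    then have "Ck_on k J g'"
      by (rule Ck_on_cong[OF J(1), rotated]) (simp add: g'_def)
    then show ?case by (rule Ck_on_real_SucI[OF J(1) der])
  qed
  show ?thesis
  proof (rule that[of J g g'])
    show "{0..} \<subseteq> J" using e(1) by (auto simp: J_def)
    show "2 * s * g' s = 1 - n * g s + s * (g s)\<^sup>2 * (1 - (real n - 1) * g s)" if "s \<ge> 0" for s
      using ode[of s] \<Phi>G[of "g s"] gpos[OF that] upper[OF that] by (simp add: G_def N_def)
  qed (fact J contg Ck der gpos)+
qed

section \<open>Radial graphs and the outer normal\<close>

lemma has_derivative_radial:
  fixes x0 :: "'a::euclidean_space"
  assumes "(F has_real_derivative d) (at ((norm (x - x0))\<^sup>2))"
  shows "((\<lambda>y. F ((norm (y - x0))\<^sup>2)) has_derivative (\<lambda>h. 2 * d * ((x - x0) \<bullet> h))) (at x)"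
proof -
  have q: "((\<lambda>x. (norm (x - x0))\<^sup>2) has_derivative (\<lambda>h. 2 * ((x - x0) \<bullet> h))) (at x)"
    unfolding power2_norm_eq_inner
    by (auto intro!: derivative_eq_intros simp: inner_commute)
  have "(F has_derivative (*) d) (at ((norm (x - x0))\<^sup>2))"
    using assms by (simp add: has_field_derivative_def)
  from has_derivative_compose[OF q this] show ?thesis
    by (simp add: mult_ac)
qed

lemma grad_eqI:
  assumes "(u has_derivative (\<lambda>h. v \<bullet> h)) (at x)"
  shows "grad u x = v"
proof -
  have "frechet_derivative u (at x) = (\<lambda>h. v \<bullet> h)"
    using frechet_derivative_at[OF assms] by simp
  then show ?thesis unfolding grad_def by (simp add: euclidean_representation)
qed

lemma divergence_radial_field:
  fixes x0 :: "'a::euclidean_space" and p :: "real \<Rightarrow> real"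
  assumes "(p has_real_derivative d) (at ((norm (x - x0))\<^sup>2))"
    and "open U" "x \<in> U" "\<And>y. y \<in> U \<Longrightarrow> V y = p ((norm (y - x0))\<^sup>2) *\<^sub>R (y - x0)"
  shows "divergence V x = DIM('a) * p ((norm (x - x0))\<^sup>2) + 2 * (norm (x - x0))\<^sup>2 * d"
proof -
  let ?p = "p ((norm (x - x0))\<^sup>2)"
  have "((\<lambda>y. p ((norm (y - x0))\<^sup>2) *\<^sub>R (y - x0)) has_derivative
      (\<lambda>h. ?p *\<^sub>R h + (2 * d * ((x - x0) \<bullet> h)) *\<^sub>R (x - x0))) (at x)"
    by (rule has_derivative_scaleR[OF has_derivative_radial[OF assms(1)]]) (auto intro!: derivative_eq_intros)
  then have "(V has_derivative (\<lambda>h. ?p *\<^sub>R h + (2 * d * ((x - x0) \<bullet> h)) *\<^sub>R (x - x0))) (at x)"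
    by (rule has_derivative_transform_within_open[OF _ assms(2,3)]) (use assms(4) in simp)
  from frechet_derivative_at[OF this, symmetric]
  have "divergence V x = (\<Sum>e\<in>Basis. (?p *\<^sub>R e + (2 * d * ((x - x0) \<bullet> e)) *\<^sub>R (x - x0)) \<bullet> e)"
    by (simp add: divergence_def)
  also have "\<dots> = (\<Sum>e\<in>Basis. ?p * (e \<bullet> e) + 2 * d * (((x - x0) \<bullet> e) * ((x - x0) \<bullet> e)))"
    by (simp add: inner_add_left inner_diff_left mult.assoc)
  also have "\<dots> = (\<Sum>e\<in>(Basis::'a set). ?p) + 2 * d * (\<Sum>e\<in>Basis. ((x - x0) \<bullet> e) * ((x - x0) \<bullet> e))"
    by (simp add: sum.distrib sum_distrib_left)
  also have "(\<Sum>e\<in>Basis. ((x - x0) \<bullet> e) * ((x - x0) \<bullet> e)) = (norm (x - x0))\<^sup>2"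
    by (simp add: power2_norm_eq_inner euclidean_inner[symmetric])
  finally show ?thesis by simp
qed

text \<open>
  For \<open>grad u = - g *\<^sub>R (x - x0)\<close> the vector field under the divergence is again radial, with factor
  \<open>- g / sqrt (1 + s * g\<^sup>2)\<close>; expanding the divergence and clearing the square root leaves a polynomial
  identity that the differential equation for \<open>g\<close> reduces to \<open>w\<^sup>2 = 1 + s * g\<^sup>2\<close>.
\<close>

lemma mean_curvature_equation_radial:
  fixes x0 :: "'a::euclidean_space" and g :: "real \<Rightarrow> real"
  assumes g: "(g has_real_derivative g1) (at ((norm (x - x0))\<^sup>2))"
    and ode: "let s = (norm (x - x0))\<^sup>2; y = g s in
      2 * s * g1 = 1 - DIM('a) * y + s * y\<^sup>2 * (1 - (real DIM('a) - 1) * y)"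
    and "open U" "x \<in> U" and u: "\<And>y. y \<in> U \<Longrightarrow> grad u y = - g ((norm (y - x0))\<^sup>2) *\<^sub>R (y - x0)"
  shows "- divergence (\<lambda>y. grad u y /\<^sub>R sqrt (1 + (norm (grad u y))\<^sup>2)) x
           = 1 / sqrt (1 + (norm (grad u x))\<^sup>2)"
proof -
  define s where "s = (norm (x - x0))\<^sup>2"
  define n where "n = real DIM('a)"
  define a where "a = g s"
  define w where "w = sqrt (1 + s * a\<^sup>2)"
  define p where "p s = - g s / sqrt (1 + s * (g s)\<^sup>2)" for s
  have s0: "s \<ge> 0" by (simp add: s_def)
  then have pos: "1 + s * a\<^sup>2 > 0" by (smt (verit) mult_nonneg_nonneg zero_le_power2)
  have w: "w > 0" "w\<^sup>2 = 1 + s * a\<^sup>2" using pos by (auto simp: w_def)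
  have norm_grad: "(norm (grad u y))\<^sup>2 = (norm (y - x0))\<^sup>2 * (g ((norm (y - x0))\<^sup>2))\<^sup>2" if "y \<in> U" for y
    using u[OF that] by (simp add: power_mult_distrib)
  have V: "grad u y /\<^sub>R sqrt (1 + (norm (grad u y))\<^sup>2) = p ((norm (y - x0))\<^sup>2) *\<^sub>R (y - x0)" if "y \<in> U" for y
    unfolding norm_grad[OF that] by (simp add: u[OF that] p_def divide_inverse mult.commute)
  have ds: "((\<lambda>s. sqrt (1 + s * (g s)\<^sup>2)) has_real_derivative (a\<^sup>2 + 2 * s * a * g1) / (2 * w)) (at s)"
  proof -
    have "((\<lambda>s. 1 + s * (g s)\<^sup>2) has_real_derivative a\<^sup>2 + 2 * s * a * g1) (at s)"
      using g unfolding s_def[symmetric] by (auto intro!: derivative_eq_intros simp: a_def)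
    from DERIV_chain2[where f=sqrt, OF DERIV_real_sqrt this] pos show ?thesis
      by (simp add: a_def w_def field_simps)
  qed
  have "(p has_real_derivative - ((g1 * w - a * ((a\<^sup>2 + 2 * s * a * g1) / (2 * w))) / (w * w))) (at s)"
    using DERIV_minus[OF DERIV_divide[OF g[folded s_def] ds]] pos
    unfolding p_def by (simp add: a_def w_def)
  from divergence_radial_field[OF this[unfolded s_def] assms(3,4) V, folded s_def]
  have "- divergence (\<lambda>y. grad u y /\<^sub>R sqrt (1 + (norm (grad u y))\<^sup>2)) x
      = n * a / w + 2 * s * ((g1 * w - a * ((a\<^sup>2 + 2 * s * a * g1) / (2 * w))) / (w * w))"
    by (simp add: p_def a_def w_def n_def)
  also have "\<dots> = (n * a * w\<^sup>2 + 2 * s * g1 * w\<^sup>2 - s * a * (a\<^sup>2 + a * (2 * s * g1))) / (w * w\<^sup>2)"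
    using w(1) by (simp add: field_simps power2_eq_square)
  also have "2 * s * g1 = 1 - n * a + s * a\<^sup>2 * (1 - (n - 1) * a)"
    using ode by (simp add: Let_def s_def[symmetric] a_def n_def)
  also have "n * a * w\<^sup>2 + (1 - n * a + s * a\<^sup>2 * (1 - (n - 1) * a)) * w\<^sup>2
      - s * a * (a\<^sup>2 + a * (1 - n * a + s * a\<^sup>2 * (1 - (n - 1) * a))) = w\<^sup>2"
    unfolding w(2) by (simp add: algebra_simps power2_eq_square)
  also have "w\<^sup>2 / (w * w\<^sup>2) = 1 / w" using w(1) by (simp add: power2_eq_square)
  also have "w = sqrt (1 + (norm (grad u x))\<^sup>2)"
    using norm_grad[OF assms(4)] by (simp add: w_def s_def a_def)
  finally show ?thesis .
qed

lemma has_derivative_grad: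
  assumes "u differentiable (at x)"
  shows "(u has_derivative (\<lambda>h. grad u x \<bullet> h)) (at x)"
proof -
  have D: "(u has_derivative frechet_derivative u (at x)) (at x)"
    using assms by (simp add: frechet_derivative_works)
  interpret linear "frechet_derivative u (at x)" by (rule has_derivative_linear[OF D])
  have "frechet_derivative u (at x) h = grad u x \<bullet> h" for h
  proof -
    have "frechet_derivative u (at x) h = frechet_derivative u (at x) (\<Sum>e\<in>Basis. (h \<bullet> e) *\<^sub>R e)"
      by (simp add: euclidean_representation)
    also have "\<dots> = grad u x \<bullet> h"
      unfolding sum scale grad_def inner_sum_left by (simp add: inner_commute mult.commute)
    finally show ?thesis .
  qed
  then show ?thesis using D by (metis ext)
qed

lemma defining_function_differentiable:
  assumes "local_defining_function \<Omega> x W \<rho>"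
  shows "\<rho> differentiable (at x)"
proof -
  have "Ck_on (Suc 0) W \<rho>" "x \<in> W"
    using assms by (auto simp: local_defining_function_def smooth_on_def)
  then show ?thesis by (simp only: Ck_on.simps)
qed

lemma descending_direction:
  assumes "(\<rho> has_derivative (\<lambda>h. a \<bullet> h)) (at x)" "\<rho> x = 0" "a \<bullet> v < 0"
  shows "\<forall>\<^sub>F t in at_right (0::real). \<rho> (x + t *\<^sub>R v) < 0"
proof -
  have "(\<rho> has_derivative (\<lambda>h. a \<bullet> h)) (at (x + 0 *\<^sub>R v))" using assms(1) by simp
  moreover have "((\<lambda>t. x + t *\<^sub>R v) has_derivative (\<lambda>h. h *\<^sub>R v)) (at 0)"
    by (auto intro!: derivative_eq_intros)
  ultimately have "((\<lambda>t. \<rho> (x + t *\<^sub>R v)) has_derivative (\<lambda>h. a \<bullet> (h *\<^sub>R v))) (at 0)"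
    by (rule has_derivative_compose[rotated])
  then have "((\<lambda>t. \<rho> (x + t *\<^sub>R v)) has_real_derivative a \<bullet> v) (at 0)"
    by (simp add: has_field_derivative_def mult_commute_abs)
  from DERIV_neg_dec_right[OF this assms(3)] obtain d where
    "d > 0" "\<And>h. 0 < h \<Longrightarrow> h < d \<Longrightarrow> \<rho> (x + h *\<^sub>R v) < 0"
    using assms(2) by auto
  then show ?thesis by (auto simp: eventually_at_right_field)
qed

text \<open>
  A direction along which \<open>\<rho>1\<close> decreases strictly points into \<open>\<Omega>\<close>, where \<open>\<rho>2\<close> is negative; so \<open>\<rho>2\<close>
  cannot increase strictly along it.
\<close>

lemma defining_function_descent_le:
  assumes 1: "local_defining_function \<Omega> x W1 \<rho>1" and 2: "local_defining_function \<Omega> x W2 \<rho>2"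
    and v: "grad \<rho>1 x \<bullet> v < 0"
  shows "grad \<rho>2 x \<bullet> v \<le> 0"
proof (rule ccontr)
  assume "\<not> ?thesis"
  then have n: "(- grad \<rho>2 x) \<bullet> v < 0" by simp
  have "\<rho>1 x = 0" "\<rho>2 x = 0" and W: "open W1" "open W2" "x \<in> W1" "x \<in> W2"
    using 1 2 by (auto simp: local_defining_function_def)
  have A: "\<forall>\<^sub>F t in at_right (0::real). \<rho>1 (x + t *\<^sub>R v) < 0"
    by (rule descending_direction[OF has_derivative_grad[OF defining_function_differentiable[OF 1]]]) fact+
  have "((\<lambda>x. - \<rho>2 x) has_derivative (\<lambda>h. (- grad \<rho>2 x) \<bullet> h)) (at x)"
    using has_derivative_minus[OF has_derivative_grad[OF defining_function_differentiable[OF 2]]] by simp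
  then have B: "\<forall>\<^sub>F t in at_right (0::real). - \<rho>2 (x + t *\<^sub>R v) < 0"
    by (rule descending_direction) (use n \<open>\<rho>2 x = 0\<close> in auto)
  have "((\<lambda>t. x + t *\<^sub>R v) \<longlongrightarrow> x + 0 *\<^sub>R v) (at_right 0)"
    by (intro tendsto_intros)
  then have C: "\<forall>\<^sub>F t in at_right (0::real). x + t *\<^sub>R v \<in> W1 \<inter> W2"
    by (rule topological_tendstoD) (use W in auto)
  have "\<forall>\<^sub>F t in at_right (0::real). False"
    using A B C
  proof eventually_elim
    case (elim t)
    then have "x + t *\<^sub>R v \<in> \<Omega> \<inter> W1" using 1 by (auto simp: local_defining_function_def)
    then have "x + t *\<^sub>R v \<in> \<Omega> \<inter> W2" using elim by auto
    then have "\<rho>2 (x + t *\<^sub>R v) < 0" using 2 unfolding local_defining_function_def by blast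
    then show ?case using elim by simp
  qed
  then show False by simp
qed

text \<open>
  The definite description in \<open>outer_normal\<close> is well defined: if two unit normals \<open>a\<close> and \<open>v\<close> were
  different, the direction \<open>v - a\<close> would satisfy \<open>a \<bullet> (v - a) < 0 < v \<bullet> (v - a)\<close>, contrary to
  \<open>defining_function_descent_le\<close>.
\<close>

lemma outer_normal_eq:
  assumes \<rho>: "local_defining_function \<Omega> x W \<rho>"
  shows "outer_normal \<Omega> x = grad \<rho> x /\<^sub>R norm (grad \<rho> x)"
  unfolding outer_normal_def
proof (rule the_equality)
  show "\<exists>W' \<rho>'. local_defining_function \<Omega> x W' \<rho>' \<and>
      grad \<rho> x /\<^sub>R norm (grad \<rho> x) = grad \<rho>' x /\<^sub>R norm (grad \<rho>' x)"
    using \<rho> by blast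
  fix v assume "\<exists>W \<rho>. local_defining_function \<Omega> x W \<rho> \<and> v = grad \<rho> x /\<^sub>R norm (grad \<rho> x)"
  then obtain W' \<rho>' where \<rho>': "local_defining_function \<Omega> x W' \<rho>'"
    and v: "v = grad \<rho>' x /\<^sub>R norm (grad \<rho>' x)" by blast
  define a where "a = grad \<rho> x /\<^sub>R norm (grad \<rho> x)"
  have nz: "grad \<rho> x \<noteq> 0" "grad \<rho>' x \<noteq> 0"
    using \<rho> \<rho>' by (auto simp: local_defining_function_def)
  have na: "norm a = 1" and nv: "norm v = 1" using nz by (auto simp: a_def v)
  have "a \<bullet> a = 1" "v \<bullet> v = 1" using na nv by (auto simp: dot_square_norm)
  show "v = grad \<rho> x /\<^sub>R norm (grad \<rho> x)"
    unfolding a_def[symmetric]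
  proof (rule ccontr)
    assume "v \<noteq> a"
    then have "(v - a) \<bullet> (v - a) > 0" by simp
    then have av: "a \<bullet> v < 1"
      using \<open>a \<bullet> a = 1\<close> \<open>v \<bullet> v = 1\<close> by (simp add: inner_diff_left inner_diff_right inner_commute)
    have "grad \<rho> x \<bullet> (v - a) = norm (grad \<rho> x) * (a \<bullet> (v - a))" using nz by (simp add: a_def)
    moreover have "a \<bullet> (v - a) < 0" using av \<open>a \<bullet> a = 1\<close> by (simp add: inner_diff_right)
    ultimately have "grad \<rho> x \<bullet> (v - a) < 0" using nz by (simp add: mult_pos_neg)
    from defining_function_descent_le[OF \<rho> \<rho>' this]
    moreover have "grad \<rho>' x \<bullet> (v - a) = norm (grad \<rho>' x) * (v \<bullet> (v - a))"
      using nz unfolding v by simp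
    ultimately have "norm (grad \<rho>' x) * (v \<bullet> (v - a)) \<le> 0" by simp
    then have "v \<bullet> (v - a) \<le> 0" using nz by (simp add: mult_le_0_iff)
    then show False using av \<open>v \<bullet> v = 1\<close> by (simp add: inner_diff_right inner_commute)
  qed
qed

section \<open>Two caps over two balls\<close>

text \<open>
  The function is prescribed on an open set only, so that two caps with different centres and heights
  can be pasted together over disjoint neighbourhoods.
\<close>

lemma radial_bowl_cap:
  fixes x0 :: "'a::euclidean_space" and u :: "'a \<Rightarrow> real" and g g' F :: "real \<Rightarrow> real"
  assumes J: "open J" "{0..} \<subseteq> J" and F: "\<And>k. Ck_on k J F"
    and dF: "\<And>s. s \<ge> 0 \<Longrightarrow> (F has_real_derivative g s / 2) (at s)"
    and dg: "\<And>s. s \<ge> 0 \<Longrightarrow> (g has_real_derivative g' s) (at s)"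
    and ode: "\<And>s. s \<ge> 0 \<Longrightarrow>
      2 * s * g' s = 1 - DIM('a) * g s + s * (g s)\<^sup>2 * (1 - (real DIM('a) - 1) * g s)"
    and U: "open U" and u: "\<And>x. x \<in> U \<Longrightarrow> u x = c - F ((norm (x - x0))\<^sup>2)"
  shows "smooth_on U u"
    and "x \<in> U \<Longrightarrow> (u has_derivative (\<lambda>h. (- g ((norm (x - x0))\<^sup>2) *\<^sub>R (x - x0)) \<bullet> h)) (at x)"
    and "x \<in> U \<Longrightarrow> - divergence (\<lambda>y. grad u y /\<^sub>R sqrt (1 + (norm (grad u y))\<^sup>2)) x
           = 1 / sqrt (1 + (norm (grad u x))\<^sup>2)"
proof -
  show "smooth_on U u"
    unfolding smooth_on_def
  proof
    fix k
    have "Ck_on k U (\<lambda>x. F ((norm (x - x0))\<^sup>2))"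
      using J by (intro Ck_on_compose[OF U J(1) _ F Ck_on_norm_sq[OF U]]) auto
    then have "Ck_on k U (\<lambda>x. c + (- 1) * F ((norm (x - x0))\<^sup>2))"
      by (intro Ck_on_add Ck_on_mult Ck_on_const U)
    then show "Ck_on k U u"
      by (rule Ck_on_cong[OF U, rotated]) (simp add: u)
  qed
  have der: "(u has_derivative (\<lambda>h. (- g ((norm (x - x0))\<^sup>2) *\<^sub>R (x - x0)) \<bullet> h)) (at x)" if "x \<in> U" for x
  proof -
    have "((\<lambda>y. c - F ((norm (y - x0))\<^sup>2)) has_derivative
        (\<lambda>h. 0 - 2 * (g ((norm (x - x0))\<^sup>2) / 2) * ((x - x0) \<bullet> h))) (at x)"
      by (intro has_derivative_diff has_derivative_const has_derivative_radial dF) simp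
    then have "(u has_derivative (\<lambda>h. 0 - 2 * (g ((norm (x - x0))\<^sup>2) / 2) * ((x - x0) \<bullet> h))) (at x)"
      by (rule has_derivative_transform_within_open[OF _ U that]) (simp add: u)
    then show ?thesis by simp
  qed
  show "x \<in> U \<Longrightarrow> (u has_derivative (\<lambda>h. (- g ((norm (x - x0))\<^sup>2) *\<^sub>R (x - x0)) \<bullet> h)) (at x)"
    by (rule der)
  show "- divergence (\<lambda>y. grad u y /\<^sub>R sqrt (1 + (norm (grad u y))\<^sup>2)) x
           = 1 / sqrt (1 + (norm (grad u x))\<^sup>2)" if "x \<in> U"
    by (rule mean_curvature_equation_radial[OF dg _ U that grad_eqI[OF der]])
       (use ode in \<open>auto simp: Let_def\<close>)
qed

text \<open>
  Near the sphere \<open>\<Omega>\<close> is the ball, which is a sublevel set of the squared distance to its centre.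
\<close>

lemma sphere_defining_function:
  fixes x0 :: "'a::euclidean_space"
  assumes R: "R > 0" and U: "open U" "\<Omega> \<inter> U = ball x0 R" and x: "x \<in> U" "x \<in> sphere x0 R"
  shows "local_defining_function \<Omega> x U (\<lambda>y. (norm (y - x0))\<^sup>2 + (- (R\<^sup>2)))"
    and "outer_normal \<Omega> x = (x - x0) /\<^sub>R R"
proof -
  let ?\<rho> = "\<lambda>y. (norm (y - x0))\<^sup>2 + (- (R\<^sup>2))"
  have nx: "norm (x - x0) = R" using x(2) by (simp add: dist_norm norm_minus_commute)
  have "(?\<rho> has_derivative (\<lambda>h. (2 *\<^sub>R (x - x0)) \<bullet> h)) (at x)"
    unfolding power2_norm_eq_inner
    by (auto intro!: derivative_eq_intros simp: inner_commute)
  then have grad: "grad ?\<rho> x = 2 *\<^sub>R (x - x0)" by (rule grad_eqI)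
  have neg: "?\<rho> y < 0 \<longleftrightarrow> y \<in> ball x0 R" for y
    using R abs_le_square_iff[of R "norm (y - x0)"] by (auto simp: dist_norm norm_minus_commute simp flip: not_le)
  show ldf: "local_defining_function \<Omega> x U ?\<rho>"
    unfolding local_defining_function_def smooth_on_def grad neg
  proof (intro conjI allI)
    show "Ck_on k U ?\<rho>" for k by (intro Ck_on_add Ck_on_norm_sq Ck_on_const U)
  qed (use U x R nx in auto)
  show "outer_normal \<Omega> x = (x - x0) /\<^sub>R R"
    unfolding outer_normal_eq[OF ldf] grad using nx R by simp
qed

text \<open>
  A shell is connected in dimension at least two, a union of two disjoint balls is not.
\<close>

lemma disjoint_balls_not_spherical_shell:
  fixes x1 x2 :: "'a::euclidean_space"
  assumes "DIM('a) \<ge> 2" "R > 0" "ball x1 R \<inter> ball x2 R = {}"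
  shows "\<not> spherical_shell (ball x1 R \<union> ball x2 R)"
proof
  assume "spherical_shell (ball x1 R \<union> ball x2 R)"
  then obtain x0 r' R' where r: "0 < r'" "r' < R'" and
    S: "ball x1 R \<union> ball x2 R = ball x0 R' - closure (ball x0 r')"
    unfolding spherical_shell_def by blast
  have "ball x0 R' - closure (ball x0 r') = {x. r' < norm (x - x0) \<and> norm (x - x0) < R'}"
    using r by (auto simp: dist_norm norm_minus_commute)
  then have "connected (ball x1 R \<union> ball x2 R)"
    using connected_annulus(1)[OF assms(1), of r' x0 R'] S by simp
  moreover have "x1 \<in> ball x1 R" "x2 \<in> ball x2 R" using assms(2) by auto
  ultimately show False
    using connectedD[of "ball x1 R \<union> ball x2 R" "ball x1 R" "ball x2 R"] assms(3) by auto
qed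

theorem proposition5p3:
  fixes x1 x2 :: "real ^ 'n" and R :: real
  assumes "CARD('n) \<ge> 2" and "R > 0" and "norm (x1 - x2) > 2 * R"
  shows "let \<Omega> = ball x1 R \<union> ball x2 R;
             \<Gamma>1 = frontier (ball x1 R);
             \<Gamma>2 = frontier (ball x2 R)
         in ball x1 R \<inter> ball x2 R = {} \<and>
            (\<exists>a b C u.
               a < b \<and> C < 0 \<and>
               smooth_up_to_boundary \<Omega> u \<and>
               (\<forall>x\<in>\<Omega>. - divergence (\<lambda>y. grad u y /\<^sub>R sqrt (1 + (norm (grad u y))\<^sup>2)) x
                         = 1 / sqrt (1 + (norm (grad u x))\<^sup>2)) \<and>
               (\<forall>x\<in>\<Gamma>1. u x = a) \<and>
               (\<forall>x\<in>\<Gamma>2. u x = b) \<and>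
               (\<forall>x\<in>frontier \<Omega>. normal_derivative \<Omega> u x = C) \<and>
               two_height_overdetermined_problem \<Omega> \<Gamma>1 \<Gamma>2 a b 0 C u) \<and>
            \<not> spherical_shell \<Omega>"
proof -
  have n: "DIM(real ^ 'n) = CARD('n)" by simp
  obtain g g' :: "real \<Rightarrow> real" and J where J: "open J" "{0..} \<subseteq> J" and contg: "continuous_on UNIV g"
    and Ckg: "\<And>k. Ck_on k J g" and dg: "\<And>s. (g has_real_derivative g' s) (at s)"
    and gpos: "\<And>s. s \<ge> 0 \<Longrightarrow> g s > 0"
    and "\<And>s. s \<ge> 0 \<Longrightarrow> 2 * s * g' s = 1 - CARD('n) * g s
      + s * (g s)\<^sup>2 * (1 - (real CARD('n) - 1) * g s)"
    by (rule bowl_profile_exists[OF assms(1)], rule that; blast)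
  note ode = this(7)[folded n]
  (* For m = 1 the lower-order term in the derivative of s * radial_mean m g s vanishes,
     so this is a primitive of g / 2 defined on both sides of 0. *)
  define F where "F s = 1 / 2 * (s * radial_mean 1 g s)" for s
  have dF: "(F has_real_derivative g s / 2) (at s)" for s
    unfolding F_def using DERIV_cmult[OF has_derivative_id_radial_mean[OF contg, of 1 s], of "1 / 2"] by simp
  have CkF: "Ck_on k J F" for k
  proof (rule Ck_on_SucD)
    have "Ck_on k J (\<lambda>s. 1 / 2 * g s)" by (intro Ck_on_mult Ck_on_const J Ckg)
    then show "Ck_on (Suc k) J F" using dF by (intro Ck_on_real_SucI[OF J(1)]) auto
  qed
  (* Half the distance of the centres is the largest radius for which the open balls around
     them are disjoint; being larger than R, it leaves room around the closed balls. *)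
  define D where "D = norm (x1 - x2) / 2"
  have RD: "R < D" using assms(3) by (simp add: D_def)
  define \<Omega> where "\<Omega> = ball x1 R \<union> ball x2 R"
  define U1 U2 where "U1 = ball x1 D" and "U2 = ball x2 D"
  have U: "open U1" "open U2" by (auto simp: U1_def U2_def)
  have disj: "U1 \<inter> U2 = {}"
    unfolding U1_def U2_def by (rule disjoint_ballI) (simp add: D_def dist_norm)
  have sub: "cball x1 R \<subseteq> U1" "cball x2 R \<subseteq> U2" using RD by (auto simp: U1_def U2_def)
  have bsub: "ball x1 R \<subseteq> U1" "ball x2 R \<subseteq> U2" "sphere x1 R \<subseteq> U1" "sphere x2 R \<subseteq> U2"
    using sub ball_subset_cball sphere_cball by blast+
  have balls: "ball x1 R \<inter> ball x2 R = {}" using bsub disj by blast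
  have \<Omega>U: "\<Omega> \<inter> U1 = ball x1 R" "\<Omega> \<inter> U2 = ball x2 R"
    using bsub disj by (auto simp: \<Omega>_def)
  have cl: "closure \<Omega> = cball x1 R \<union> cball x2 R"
    using assms(2) by (simp add: \<Omega>_def closure_Un)
  have fr: "frontier \<Omega> = sphere x1 R \<union> sphere x2 R"
  proof -
    have "open \<Omega>" by (simp add: \<Omega>_def open_Un)
    then have "frontier \<Omega> = (cball x1 R \<union> cball x2 R) - (ball x1 R \<union> ball x2 R)"
      by (simp add: frontier_def cl interior_open) (simp add: \<Omega>_def)
    also have "\<dots> = (cball x1 R - ball x1 R) \<union> (cball x2 R - ball x2 R)"
      using sub bsub disj by blast
    also have "\<dots> = sphere x1 R \<union> sphere x2 R" by (auto simp: dist_norm)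
    finally show ?thesis .
  qed
  (* The bowl is turned upside down; the heights on the two boundary spheres become 0 and 1. *)
  define u where "u x = (if x \<in> U1 then F (R\<^sup>2) - F ((norm (x - x1))\<^sup>2)
                                  else 1 + F (R\<^sup>2) - F ((norm (x - x2))\<^sup>2))" for x
  have u1: "u x = F (R\<^sup>2) - F ((norm (x - x1))\<^sup>2)" if "x \<in> U1" for x
    using that by (simp add: u_def)
  have u2: "u x = (1 + F (R\<^sup>2)) - F ((norm (x - x2))\<^sup>2)" if "x \<in> U2" for x
    using that disj by (auto simp: u_def)
  note cap1 = radial_bowl_cap[OF J CkF dF dg ode U(1) u1]
  note cap2 = radial_bowl_cap[OF J CkF dF dg ode U(2) u2]
  define C where "C = - (R * g (R\<^sup>2))"
  have "C < 0" using gpos[of "R\<^sup>2"] assms(2) by (simp add: C_def)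
  have smooth: "smooth_up_to_boundary \<Omega> u"
    unfolding smooth_up_to_boundary_def
  proof (intro exI conjI)
    show "open (U1 \<union> U2)" using U by blast
    show "closure \<Omega> \<subseteq> U1 \<union> U2" using sub by (auto simp: cl)
    show "smooth_on (U1 \<union> U2) u"
      using cap1(1) cap2(1) U by (auto simp: smooth_on_def intro!: Ck_on_Un)
  qed
  have pde: "- divergence (\<lambda>y. grad u y /\<^sub>R sqrt (1 + (norm (grad u y))\<^sup>2)) x
      = 1 / sqrt (1 + (norm (grad u x))\<^sup>2)" if "x \<in> \<Omega>" for x
    using that bsub cap1(3)[of x] cap2(3)[of x] unfolding \<Omega>_def by blast
  have normal: "frechet_derivative u (at x) ((x - x0) /\<^sub>R R) = C"
    if "(u has_derivative (\<lambda>h. (- g ((norm (x - x0))\<^sup>2) *\<^sub>R (x - x0)) \<bullet> h)) (at x)" "x \<in> sphere x0 R" for x x0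
  proof -
    have "norm (x - x0) = R" using that(2) by (simp add: dist_norm norm_minus_commute)
    then show ?thesis
      using frechet_derivative_at[OF that(1), symmetric] assms(2)
      by (simp add: C_def dot_square_norm power2_eq_square)
  qed
  have neumann: "normal_derivative \<Omega> u x = C" if x: "x \<in> frontier \<Omega>" for x
  proof -
    consider "x \<in> sphere x1 R" | "x \<in> sphere x2 R" using x unfolding fr by blast
    then show ?thesis
    proof cases
      case 1
      then have "x \<in> U1" using bsub by blast
      then show ?thesis
        using normal[OF cap1(2) 1] sphere_defining_function(2)[OF assms(2) U(1) \<Omega>U(1) _ 1]
        by (simp add: normal_derivative_def)
    next
      case 2
      then have "x \<in> U2" using bsub by blast
      then show ?thesis
        using normal[OF cap2(2) 2] sphere_defining_function(2)[OF assms(2) U(2) \<Omega>U(2) _ 2]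
        by (simp add: normal_derivative_def)
    qed
  qed
  have boundary: "smooth_boundary \<Omega>"
    unfolding smooth_boundary_def fr
    using sphere_defining_function(1)[OF assms(2) U(1) \<Omega>U(1)]
      sphere_defining_function(1)[OF assms(2) U(2) \<Omega>U(2)] bsub by blast
  have dirichlet: "\<forall>x\<in>sphere x1 R. u x = 0" "\<forall>x\<in>sphere x2 R. u x = 1"
    using u1 u2 bsub(3,4) by (auto simp: dist_norm norm_minus_commute subset_iff)
  have spheres: "sphere x1 R \<inter> sphere x2 R = {}" using bsub disj by blast
  have \<Omega>: "open \<Omega>" "bounded \<Omega>" by (auto simp: \<Omega>_def)
  have fb: "frontier (ball x1 R) = sphere x1 R" "frontier (ball x2 R) = sphere x2 R"
    using assms(2) by (auto simp: frontier_ball)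
  have "two_height_overdetermined_problem \<Omega> (sphere x1 R) (sphere x2 R) 0 1 0 C u"
    unfolding two_height_overdetermined_problem_def
    using \<Omega> boundary fr spheres smooth pde dirichlet neumann by simp
  then have ex: "\<exists>a b C u. a < b \<and> C < 0 \<and> smooth_up_to_boundary \<Omega> u \<and>
       (\<forall>x\<in>\<Omega>. - divergence (\<lambda>y. grad u y /\<^sub>R sqrt (1 + (norm (grad u y))\<^sup>2)) x
                 = 1 / sqrt (1 + (norm (grad u x))\<^sup>2)) \<and>
       (\<forall>x\<in>sphere x1 R. u x = a) \<and> (\<forall>x\<in>sphere x2 R. u x = b) \<and>
       (\<forall>x\<in>frontier \<Omega>. normal_derivative \<Omega> u x = C) \<and>
       two_height_overdetermined_problem \<Omega> (sphere x1 R) (sphere x2 R) a b 0 C u"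
    using \<open>C < 0\<close> smooth pde dirichlet neumann zero_less_one by blast
  have "\<not> spherical_shell \<Omega>"
    unfolding \<Omega>_def by (rule disjoint_balls_not_spherical_shell) (use assms balls in auto)
  with ex balls show ?thesis
    unfolding Let_def fb \<Omega>_def[symmetric] by blast
qed

end
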